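(* For every integer $r\ge 2$ there exists a finite hypergraph $H$ with maximum edge size $r$ such that $H$ is linear, $2$-regular and bipartite, no edge of $H$ consists of a twin set, and there is no weighting $\rho:E(H)\to\{1,2,\ldots,r\}$ for which the induced vertex weights $\rho(v):=\sum_{e\in E(H),\, e\ni v}\rho(e)$, $v\in V(H)$, properly color $V(H)$.
   Context: A hypergraph $H$ consists of a vertex set $V(H)$ and a collection $E(H)$ of subsets of $V(H)$, called edges; multiple edges are in general allowed. Edges need not have the same size. A function on $V(H)$ properly colors $V(H)$ if no edge is monochromatic, i.e. every edge contains at least two vertices with different values. A hypergraph is bipartite if it has a proper coloring with $2$ colors. It is linear if any two distinct edges intersect in at most one vertex. It is $2$-regular if every vertex lies in exactly two edges. A set of vertices of any cardinality is called a twin set if all vertices in the set are contained in exactly the same set of edges; an edge consists of a twin set if its vertex set is a twin set. *)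

theory Defs
  imports Main "HOL-Library.FuncSet"
begin

text \<open>Edges are names carrying a vertex set rather than vertex sets themselves, so that
  multiple edges are possible and a weighting may distinguish them.\<close>

record ('v, 'e) hypergraph =
  verts :: "'v set"
  edges :: "'e set"
  vset :: "'e \<Rightarrow> 'v set"

definition finite_hypergraph :: "('v, 'e) hypergraph \<Rightarrow> bool" where
  "finite_hypergraph H \<longleftrightarrow>
     finite (verts H) \<and> finite (edges H) \<and> (\<forall>e\<in>edges H. vset H e \<subseteq> verts H)"

definition incident_edges :: "('v, 'e) hypergraph \<Rightarrow> 'v \<Rightarrow> 'e set" where
  "incident_edges H v = {e \<in> edges H. v \<in> vset H e}"

text \<open>The maximum is required to be attained, so the hypergraph has an edge.\<close>

definition max_edge_size :: "('v, 'e) hypergraph \<Rightarrow> nat \<Rightarrow> bool" where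
  "max_edge_size H r \<longleftrightarrow>
     (\<forall>e\<in>edges H. card (vset H e) \<le> r) \<and> (\<exists>e\<in>edges H. card (vset H e) = r)"

definition properly_colors :: "('v, 'e) hypergraph \<Rightarrow> ('v \<Rightarrow> 'c) \<Rightarrow> bool" where
  "properly_colors H c \<longleftrightarrow>
     (\<forall>e\<in>edges H. \<exists>u\<in>vset H e. \<exists>v\<in>vset H e. c u \<noteq> c v)"

definition bipartite :: "('v, 'e) hypergraph \<Rightarrow> bool" where
  "bipartite H \<longleftrightarrow> (\<exists>c :: 'v \<Rightarrow> bool. properly_colors H c)"

text \<open>Avoids \<^const>\<open>card\<close>, which is 0 on infinite intersections.\<close>

definition linear_hypergraph :: "('v, 'e) hypergraph \<Rightarrow> bool" where
  "linear_hypergraph H \<longleftrightarrow>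
     (\<forall>e\<in>edges H. \<forall>f\<in>edges H. e \<noteq> f \<longrightarrow>
        (\<forall>u\<in>vset H e \<inter> vset H f. \<forall>v\<in>vset H e \<inter> vset H f. u = v))"

definition two_regular :: "('v, 'e) hypergraph \<Rightarrow> bool" where
  "two_regular H \<longleftrightarrow> (\<forall>v\<in>verts H. card (incident_edges H v) = 2)"

definition twin_set :: "('v, 'e) hypergraph \<Rightarrow> 'v set \<Rightarrow> bool" where
  "twin_set H S \<longleftrightarrow>
     S \<subseteq> verts H \<and> (\<forall>u\<in>S. \<forall>v\<in>S. incident_edges H u = incident_edges H v)"

definition vertex_weight :: "('v, 'e) hypergraph \<Rightarrow> ('e \<Rightarrow> nat) \<Rightarrow> 'v \<Rightarrow> nat" where
  "vertex_weight H \<rho> v = (\<Sum>e\<in>incident_edges H v. \<rho> e)"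

end

theory Submission
  imports Defs "HOL-Library.Nat_Bijection"
begin

text \<open>
  A 2-regular linear hypergraph is the dual of a simple graph \<open>G\<close>: hyperedges are the vertices of
  \<open>G\<close> and vertices are its edges. An edge weighting becomes a labelling of the vertices of \<open>G\<close>, and
  it induces a proper coloring iff every vertex of \<open>G\<close> has two differently labelled neighbours.
  Take for \<open>G\<close> the complete graph on \<open>r + 1\<close> vertices with every edge subdivided once. The
  subdivision vertices force the \<open>r + 1\<close> original vertices to have distinct labels, which is
  impossible with \<open>r\<close> labels. A 2-coloring that is proper at the subdivision vertices is an
  orientation of the complete graph, and it is proper at the original vertices iff there are no
  sources and sinks: orient along the order of \<open>{0..r}\<close>, except for the edge from \<open>r\<close> back to \<open>0\<close>.
\<close>

text \<open>The vertex coded by \<open>(i, j)\<close> is the half of the edge \<open>ij\<close> at \<open>i\<close>. The hyperedge coded by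
  \<open>(i, i)\<close> is the original vertex \<open>i\<close>, and the one coded by \<open>(i, j)\<close> with \<open>i < j\<close> is the
  subdivision vertex of the edge \<open>ij\<close>.\<close>

definition subdivided_complete_dual :: "nat \<Rightarrow> (nat, nat) hypergraph" where
  "subdivided_complete_dual r =
     \<lparr>verts = prod_encode ` {(i, j). i \<le> r \<and> j \<le> r \<and> i \<noteq> j},
      edges = prod_encode ` {(i, j). i \<le> j \<and> j \<le> r},
      vset = (\<lambda>e. prod_encode ` (case prod_decode e of (i, j) \<Rightarrow>
        if i = j then {i} \<times> ({..r} - {i}) else {(i, j), (j, i)}))\<rparr>"

lemma verts_subdivided:
  "verts (subdivided_complete_dual r) = prod_encode ` {(i, j). i \<le> r \<and> j \<le> r \<and> i \<noteq> j}"
  by (simp add: subdivided_complete_dual_def)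

lemma edges_subdivided:
  "edges (subdivided_complete_dual r) = prod_encode ` {(i, j). i \<le> j \<and> j \<le> r}"
  by (simp add: subdivided_complete_dual_def)

lemma vset_subdivided:
  "vset (subdivided_complete_dual r) (prod_encode (i, j)) =
     prod_encode ` (if i = j then {i} \<times> ({..r} - {i}) else {(i, j), (j, i)})"
  by (simp add: subdivided_complete_dual_def)

lemma edge_subdivided_cases [consumes 1, case_names original subdivision]:
  assumes "e \<in> edges (subdivided_complete_dual r)"
  obtains i where "i \<le> r" "e = prod_encode (i, i)"
      "vset (subdivided_complete_dual r) e = prod_encode ` ({i} \<times> ({..r} - {i}))"
  | i j where "i < j" "j \<le> r" "e = prod_encode (i, j)"
      "vset (subdivided_complete_dual r) e = {prod_encode (i, j), prod_encode (j, i)}"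
proof -
  obtain i j where e: "e = prod_encode (i, j)" "i \<le> j" "j \<le> r"
    using assms by (auto simp: edges_subdivided)
  show ?thesis
  proof (cases "i = j")
    case True
    show ?thesis
      by (rule that(1)[of j]) (use e True in \<open>simp_all add: vset_subdivided\<close>)
  next
    case False
    show ?thesis
      by (rule that(2)[of i j]) (use e False in \<open>simp_all add: vset_subdivided\<close>)
  qed
qed

text \<open>A vertex is an ordered pair, but only the increasing pair names a subdivision hyperedge;
  hence \<open>min\<close> and \<open>max\<close>.\<close>

lemma incident_edges_subdivided:
  assumes "i \<le> r" "j \<le> r" "i \<noteq> j"
  shows "incident_edges (subdivided_complete_dual r) (prod_encode (i, j)) =
     {prod_encode (i, i), prod_encode (min i j, max i j)}"
  using assms
  by (auto simp: incident_edges_def edges_subdivided vset_subdivided image_iff min_def max_def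
      split: if_splits)

lemma finite_subdivided: "finite_hypergraph (subdivided_complete_dual r)"
proof -
  have "{(i, j). i \<le> r \<and> j \<le> r \<and> i \<noteq> j} \<subseteq> {..r} \<times> {..r}"
    "{(i, j). i \<le> j \<and> j \<le> r} \<subseteq> {..r} \<times> {..r}"
    by auto
  then have "finite {(i, j). i \<le> r \<and> j \<le> r \<and> i \<noteq> j}" "finite {(i, j). i \<le> j \<and> j \<le> r}"
    by (simp_all add: finite_subset[OF _ finite_cartesian_product[of "{..r}" "{..r}"]])
  moreover have "vset (subdivided_complete_dual r) e \<subseteq> verts (subdivided_complete_dual r)"
    if "e \<in> edges (subdivided_complete_dual r)" for e
    using that by (cases rule: edge_subdivided_cases) (auto simp: verts_subdivided)
  ultimately show ?thesis
    by (simp add: finite_hypergraph_def verts_subdivided edges_subdivided)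
qed

lemma max_edge_size_subdivided:
  assumes "r \<ge> 2"
  shows "max_edge_size (subdivided_complete_dual r) r"
proof -
  have original: "card (prod_encode ` ({i} \<times> ({..r} - {i}))) = r" if "i \<le> r" for i
    using that by (simp add: card_image inj_prod_encode card_cartesian_product)
  have "card (vset (subdivided_complete_dual r) e) \<le> r"
    if "e \<in> edges (subdivided_complete_dual r)" for e
    using that by (cases rule: edge_subdivided_cases) (use original assms in auto)
  moreover have "prod_encode (0, 0) \<in> edges (subdivided_complete_dual r)"
    by (simp add: edges_subdivided)
  moreover have "card (vset (subdivided_complete_dual r) (prod_encode (0, 0))) = r"
    using original[of 0] by (simp add: vset_subdivided)
  ultimately show ?thesis
    unfolding max_edge_size_def by blast
qed

text \<open>Two original hyperedges are disjoint, since their pairs have different first components,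
  and so are two subdivision hyperedges. The original hyperedge \<open>i\<close> can meet a
  subdivision hyperedge only in its pair that starts with \<open>i\<close>.\<close>

lemma linear_subdivided: "linear_hypergraph (subdivided_complete_dual r)"
proof -
  have "u = v"
    if "e \<in> edges (subdivided_complete_dual r)" "f \<in> edges (subdivided_complete_dual r)" "e \<noteq> f"
      and "u \<in> vset (subdivided_complete_dual r) e" "v \<in> vset (subdivided_complete_dual r) e"
      and "u \<in> vset (subdivided_complete_dual r) f" "v \<in> vset (subdivided_complete_dual r) f"
    for e f u v
    using that(1)
  proof (cases rule: edge_subdivided_cases)
    case e: (original i)
    from that(2) show ?thesis
      by (cases rule: edge_subdivided_cases) (use that(3-) e in auto)
  next
    case e: (subdivision i j)
    from that(2) show ?thesis
      by (cases rule: edge_subdivided_cases) (use that(3-) e in auto)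
  qed
  then show ?thesis
    unfolding linear_hypergraph_def by blast
qed

lemma two_regular_subdivided: "two_regular (subdivided_complete_dual r)"
  by (auto simp: two_regular_def verts_subdivided incident_edges_subdivided min_def max_def)

lemma bipartite_subdivided:
  assumes "r \<ge> 2"
  shows "bipartite (subdivided_complete_dual r)"
proof -
  \<comment> \<open>\<open>out i j\<close> means that the edge \<open>ij\<close> points away from
    \<open>i\<close>; the color of a half-edge records whether it is outgoing.\<close>
  define out where "out i j \<longleftrightarrow> i < j \<and> (i, j) \<noteq> (0, r) \<or> (i, j) = (r, 0)" for i j :: nat
  define c where "c v = case_prod out (prod_decode v)" for v
  have "\<exists>u\<in>vset (subdivided_complete_dual r) e. \<exists>v\<in>vset (subdivided_complete_dual r) e. c u \<noteq> c v"
    if "e \<in> edges (subdivided_complete_dual r)" for e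
    using that
  proof (cases rule: edge_subdivided_cases)
    case (original i)
    \<comment> \<open>The vertex \<open>i\<close> is neither a sink (witness \<open>j\<close>) nor a
      source (witness \<open>k\<close>). At the ends \<open>0\<close> and \<open>r\<close>, the
      vertex \<open>1\<close> serves as a third vertex.\<close>
    have "\<exists>j k. j \<le> r \<and> j \<noteq> i \<and> k \<le> r \<and> k \<noteq> i \<and> out i j \<and> \<not> out i k"
    proof -
      consider "i = 0" | "i = r" | "0 < i" "i < r"
        using \<open>i \<le> r\<close> by linarith
      then show ?thesis
      proof cases
        case 1
        then show ?thesis
          using assms by (intro exI[of _ 1] exI[of _ r]) (auto simp: out_def)
      next
        case 2
        then show ?thesis
          using assms by (intro exI[of _ 0] exI[of _ 1]) (auto simp: out_def)
      next
        case 3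
        then show ?thesis
          by (intro exI[of _ r] exI[of _ 0]) (auto simp: out_def)
      qed
    qed
    then obtain j k where jk: "j \<le> r" "j \<noteq> i" "k \<le> r" "k \<noteq> i" "out i j" "\<not> out i k"
      by blast
    then have "prod_encode (i, j) \<in> vset (subdivided_complete_dual r) e"
      "prod_encode (i, k) \<in> vset (subdivided_complete_dual r) e"
      by (auto simp: original(3))
    moreover have "c (prod_encode (i, j)) \<noteq> c (prod_encode (i, k))"
      using jk by (simp add: c_def)
    ultimately show ?thesis
      by blast
  next
    case (subdivision i j)
    then have "c (prod_encode (i, j)) \<noteq> c (prod_encode (j, i))"
      using assms by (auto simp: c_def out_def)
    then show ?thesis
      using subdivision(4) by blast
  qed
  then show ?thesis
    unfolding bipartite_def properly_colors_def by blast
qed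

text \<open>A properly colored edge has two vertices. If they were twins, the second edge through
  one would contain both, against linearity.\<close>

lemma not_twin_set_edge:
  assumes "linear_hypergraph H" "two_regular H" "properly_colors H c" "e \<in> edges H"
  shows "\<not> twin_set H (vset H e)"
proof
  assume twin: "twin_set H (vset H e)"
  obtain u v where uv: "u \<in> vset H e" "v \<in> vset H e" "u \<noteq> v"
    using assms(3,4) unfolding properly_colors_def by metis
  \<comment> \<open>That \<open>u\<close> lies in \<open>verts H\<close> is part of the twin set
    assumption.\<close>
  have "card (incident_edges H u) = 2"
    using twin uv(1) assms(2) unfolding twin_set_def two_regular_def by blast
  then obtain a b where "incident_edges H u = {a, b}" "a \<noteq> b"
    by (meson card_2_iff)
  then obtain f where f: "f \<in> incident_edges H u" "f \<noteq> e"
    by (metis insertCI)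
  moreover have "f \<in> incident_edges H v"
    using twin uv(1,2) f(1) unfolding twin_set_def by blast
  ultimately have "f \<in> edges H" "u \<in> vset H e \<inter> vset H f" "v \<in> vset H e \<inter> vset H f"
    using uv by (simp_all add: incident_edges_def)
  then show False
    using assms(1,4) f(2) uv(3) unfolding linear_hypergraph_def by metis
qed

lemma no_proper_weighting_subdivided:
  assumes "\<rho> \<in> edges (subdivided_complete_dual r) \<rightarrow> {1..r}"
  shows "\<not> properly_colors (subdivided_complete_dual r)
    (vertex_weight (subdivided_complete_dual r) \<rho>)"
proof
  assume proper: "properly_colors (subdivided_complete_dual r)
    (vertex_weight (subdivided_complete_dual r) \<rho>)"
  define l where "l i = \<rho> (prod_encode (i, i))" for i
  have "l ` {..r} \<subseteq> {1..r}"
    using assms by (auto simp: l_def edges_subdivided Pi_iff)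
  then have "card (l ` {..r}) < card {..r}"
    using card_mono[of "{1..r}" "l ` {..r}"] by simp
  then have "\<not> inj_on l {..r}"
    by (rule pigeonhole)
  then obtain i j where ij: "i < j" "j \<le> r" "l i = l j"
    using linorder_inj_onI'[of "{..r}" l] by (metis atMost_iff)
  have weight: "vertex_weight (subdivided_complete_dual r) \<rho> (prod_encode (a, b)) =
      l a + \<rho> (prod_encode (min a b, max a b))" if "a \<le> r" "b \<le> r" "a \<noteq> b" for a b
    using that
    by (auto simp: vertex_weight_def incident_edges_subdivided l_def min_def max_def)
  \<comment> \<open>Both halves of \<open>ij\<close> receive the same summand from the subdivision
    hyperedge, so \<open>l i = l j\<close> makes it monochromatic.\<close>
  have "vertex_weight (subdivided_complete_dual r) \<rho> (prod_encode (i, j)) =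
      vertex_weight (subdivided_complete_dual r) \<rho> (prod_encode (j, i))"
    using ij by (simp add: weight min.commute max.commute)
  moreover have "prod_encode (i, j) \<in> edges (subdivided_complete_dual r)"
    using ij by (simp add: edges_subdivided)
  moreover have "vset (subdivided_complete_dual r) (prod_encode (i, j)) =
      {prod_encode (i, j), prod_encode (j, i)}"
    using ij by (simp add: vset_subdivided)
  ultimately show False
    using proper unfolding properly_colors_def by fastforce
qed

theorem mainTheorem2:
  fixes r :: nat
  assumes "r \<ge> 2"
  shows "\<exists>H :: (nat, nat) hypergraph.
    finite_hypergraph H \<and>
    max_edge_size H r \<and>
    linear_hypergraph H \<and>
    two_regular H \<and>
    bipartite H \<and>
    (\<forall>e\<in>edges H. \<not> twin_set H (vset H e)) \<and>
    \<not> (\<exists>\<rho>. \<rho> \<in> edges H \<rightarrow> {1..r} \<and> properly_colors H (vertex_weight H \<rho>))"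
proof (intro exI[of _ "subdivided_complete_dual r"] conjI)
  show "\<forall>e\<in>edges (subdivided_complete_dual r).
      \<not> twin_set (subdivided_complete_dual r) (vset (subdivided_complete_dual r) e)"
    using not_twin_set_edge[OF linear_subdivided two_regular_subdivided]
      bipartite_subdivided[OF assms] unfolding bipartite_def by blast
  show "\<not> (\<exists>\<rho>. \<rho> \<in> edges (subdivided_complete_dual r) \<rightarrow> {1..r} \<and>
      properly_colors (subdivided_complete_dual r)
        (vertex_weight (subdivided_complete_dual r) \<rho>))"
    using no_proper_weighting_subdivided by blast
qed (simp_all add: assms finite_subdivided max_edge_size_subdivided linear_subdivided
    two_regular_subdivided bipartite_subdivided)

end
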